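(* Let $N\ge 1$ and $n\ge 1$ be integers. Then $$ BC_{N,n}=\Pi(n)\sum_{k=1}^{n}\binom{n+1}{k+1}\frac{(-D_N)^k\,\Pi(k)}{\Pi(n+k r^N)}\left\{ {n+k r^N}\atop{k}\right\}_{C,\ge N}. $$
   Context: Let $r$ be a power of a prime, $T$ an indeterminate and $K=\mathbb F_r(T)$. For $i\ge 1$ put $[i]=T^{r^i}-T$ and $D_i=[i][i-1]^r\cdots[1]^{r^{i-1}}$, with $D_0=1$. The Carlitz exponential is $e_C(x)=\sum_{i=0}^\infty x^{r^i}/D_i\in K[[x]]$, and its partial sums are $\mathcal E_m(x)=\sum_{i=0}^m x^{r^i}/D_i$ (with $\mathcal E_{-1}=0$). For a non-negative integer $i$ with base-$r$ expansion $i=\sum_{j=0}^m c_j r^j$ ($0\le c_j<r$), the Carlitz factorial is $\Pi(i)=\prod_{j=0}^m D_j^{c_j}$. For $N\ge 1$, the truncated Bernoulli-Carlitz numbers $BC_{N,n}$ are defined by $$ \frac{x^{r^N}/D_N}{e_C(x)-\sum_{i=0}^{N-1}x^{r^i}/D_i}=\sum_{n=0}^\infty\frac{BC_{N,n}}{\Pi(n)}x^n . $$ The associated Stirling-Carlitz numbers of the second kind $\left\{ {n}\atop{k}\right\}_{C,\ge m}$ are defined by $$ \frac{\bigl(e_C(z)-\mathcal E_{m-1}(z)\bigr)^k}{\Pi(k)}=\sum_{n=0}^\infty\left\{ {n}\atop{k}\right\}_{C,\ge m}\frac{z^n}{\Pi(n)} . $$ Binomial coefficients are ordinary integers viewed in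 $K$. *)

theory Defs
  imports "HOL-Computational_Algebra.Computational_Algebra" "HOL-Library.Cardinality"
begin

text \<open>
  The finite field with r elements is a type \<open>'a\<close> of class \<open>{field, finite}\<close>, so r is
  \<open>CARD('a)\<close> (automatically a prime power), and K is \<open>'a poly fract\<close>.
\<close>

definition carlitz_T :: "'a::{field,finite} poly fract" where
  "carlitz_T = to_fract [:0, 1:]"

definition carlitz_bracket :: "nat \<Rightarrow> 'a::{field,finite} poly fract" where
  "carlitz_bracket i = carlitz_T ^ (CARD('a) ^ i) - carlitz_T"

definition carlitz_D :: "nat \<Rightarrow> 'a::{field,finite} poly fract" where
  "carlitz_D i = (\<Prod>j=1..i. carlitz_bracket j ^ (CARD('a) ^ (i - j)))"

definition carlitz_exp_term :: "nat \<Rightarrow> 'a::{field,finite} poly fract fps" where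
  "carlitz_exp_term i = fps_const (1 / carlitz_D i) * fps_X ^ (CARD('a) ^ i)"

text \<open>
  The infinite sum is taken in the X-adic topology on formal power series; it converges,
  see \<open>carlitz_exp_sums\<close> below.
\<close>

definition carlitz_exp :: "'a::{field,finite} poly fract fps" where
  "carlitz_exp = (\<Sum>i. carlitz_exp_term i)"

text \<open>
  The sum runs over \<open>i < m\<close>, not \<open>i \<le> m\<close>: this is the partial sum usually indexed by
  \<open>m - 1\<close>, and it is 0 for \<open>m = 0\<close>.
\<close>

definition carlitz_exp_partial :: "nat \<Rightarrow> 'a::{field,finite} poly fract fps" where
  "carlitz_exp_partial m = (\<Sum>i<m. carlitz_exp_term i)"

text \<open>
  The exponent \<open>(n div r ^ j) mod r\<close> is the j-th base-r digit of n, and \<open>r ^ j \<le> n\<close> says that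
  j does not exceed the position of the leading digit.
\<close>

definition carlitz_fact :: "nat \<Rightarrow> 'a::{field,finite} poly fract" where
  "carlitz_fact n =
     (\<Prod>j | CARD('a) ^ j \<le> n. carlitz_D j ^ ((n div CARD('a) ^ j) mod CARD('a)))"

text \<open>
  The quotient is the library's division of power series. Numerator and denominator both have
  order \<open>r ^ N\<close>, so it is the exact quotient, see \<open>BC_generating_function\<close> below.
\<close>

definition BC :: "nat \<Rightarrow> nat \<Rightarrow> 'a::{field,finite} poly fract" where
  "BC N n = carlitz_fact n *
     fps_nth (carlitz_exp_term N / (carlitz_exp - carlitz_exp_partial N)) n"

definition stirling_carlitz :: "nat \<Rightarrow> nat \<Rightarrow> nat \<Rightarrow> 'a::{field,finite} poly fract" where
  "stirling_carlitz m n k = carlitz_fact n *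
     fps_nth (fps_const (1 / carlitz_fact k) * (carlitz_exp - carlitz_exp_partial m) ^ k) n"


lemma CARD_field_ge_2: "2 \<le> CARD('a::{field,finite})"
proof -
  have "card {0, 1 :: 'a} \<le> CARD('a)" by (intro card_mono) auto
  thus ?thesis by simp
qed

lemma carlitz_bracket_nonzero:
  assumes "i \<ge> 1"
  shows "carlitz_bracket i \<noteq> (0 :: 'a::{field,finite} poly fract)"
proof
  assume "carlitz_bracket i = (0 :: 'a poly fract)"
  moreover have "to_fract p ^ k = to_fract (p ^ k)" for p :: "'a poly" and k
    by (induction k) simp_all
  ultimately have "to_fract (monom (1::'a) 1 ^ (CARD('a) ^ i)) = to_fract (monom (1::'a) 1)"
    by (simp add: carlitz_bracket_def carlitz_T_def monom_altdef)
  hence "monom (1::'a) (CARD('a) ^ i) = monom 1 1" 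
    by (simp add: monom_power)
  hence "degree (monom (1::'a) (CARD('a) ^ i)) = degree (monom (1::'a) 1)" by simp
  hence "CARD('a) ^ i = 1" by (simp add: degree_monom_eq)
  thus False using CARD_field_ge_2[where 'a='a] assms by simp
qed

lemma carlitz_D_nonzero: "carlitz_D i \<noteq> (0 :: 'a::{field,finite} poly fract)"
  unfolding carlitz_D_def using carlitz_bracket_nonzero[where 'a='a] by auto

lemma carlitz_fact_nonzero: "carlitz_fact n \<noteq> (0 :: 'a::{field,finite} poly fract)"
proof -
  have "finite {j. CARD('a) ^ j \<le> n}"
  proof (rule finite_subset)
    show "{j. CARD('a) ^ j \<le> n} \<subseteq> {..n}"
    proof (clarsimp)
      fix j assume "CARD('a) ^ j \<le> n"
      moreover have "j < CARD('a) ^ j"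
        using CARD_field_ge_2[where 'a='a] by (intro power_gt_expt) auto
      ultimately show "j \<le> n" by linarith
    qed
  qed simp
  thus ?thesis unfolding carlitz_fact_def by (simp add: carlitz_D_nonzero)
qed

lemma carlitz_exp_term_nth:
  "fps_nth (carlitz_exp_term i :: 'a::{field,finite} poly fract fps) n =
     (if n = CARD('a) ^ i then 1 / carlitz_D i else 0)"
  by (simp add: carlitz_exp_term_def)

lemma carlitz_exp_sums:
  "(carlitz_exp_term :: nat \<Rightarrow> 'a::{field,finite} poly fract fps) sums carlitz_exp"
proof -
  let ?c = "\<lambda>n. \<Sum>i\<le>n. fps_nth (carlitz_exp_term i :: 'a poly fract fps) n"
  have "carlitz_exp_term sums Abs_fps ?c"
    unfolding sums_def
  proof (rule tendsto_fpsI)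
    fix n
    show "\<forall>\<^sub>F m in sequentially. fps_nth (\<Sum>i<m. carlitz_exp_term i) n = fps_nth (Abs_fps ?c) n"
      using eventually_gt_at_top[of n]
    proof eventually_elim
      case (elim m)
      have "fps_nth (carlitz_exp_term i :: 'a poly fract fps) n = 0" if "i > n" for i
      proof -
        have "i < CARD('a) ^ i"
          using CARD_field_ge_2[where 'a='a] by (intro power_gt_expt) auto
        thus ?thesis using that by (simp add: carlitz_exp_term_nth)
      qed
      hence "(\<Sum>i<m. fps_nth (carlitz_exp_term i :: 'a poly fract fps) n) = ?c n"
        using elim by (intro sum.mono_neutral_right) auto
      thus ?case by (simp add: fps_sum_nth)
    qed
  qed
  thus ?thesis unfolding carlitz_exp_def using sums_unique by metis
qed

lemma carlitz_exp_diff_nth: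
  "fps_nth (carlitz_exp - carlitz_exp_partial m :: 'a::{field,finite} poly fract fps) n =
     (\<Sum>i | m \<le> i \<and> n = CARD('a) ^ i. 1 / carlitz_D i)"
proof -
  have exp_gt: "i < CARD('a) ^ i" for i
    using CARD_field_ge_2[where 'a='a] by (intro power_gt_expt) auto
  have "(\<lambda>M. \<Sum>i<M. carlitz_exp_term i) \<longlonglongrightarrow> (carlitz_exp :: 'a poly fract fps)"
    using carlitz_exp_sums unfolding sums_def .
  hence "\<forall>\<^sub>F M in sequentially.
      fps_nth (\<Sum>i<M. carlitz_exp_term i) n = fps_nth (carlitz_exp :: 'a poly fract fps) n"
    unfolding tendsto_fps_iff by blast
  hence "\<forall>\<^sub>F M in sequentially. M > n \<and> M \<ge> m \<and>
      fps_nth (\<Sum>i<M. carlitz_exp_term i) n = fps_nth (carlitz_exp :: 'a poly fract fps) n"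
    using eventually_gt_at_top[of n] eventually_ge_at_top[of m] by eventually_elim auto
  then obtain M where M: "M > n" "M \<ge> m"
      "fps_nth (\<Sum>i<M. carlitz_exp_term i) n = fps_nth (carlitz_exp :: 'a poly fract fps) n"
    using eventually_happens'[OF sequentially_bot] by blast
  have "fps_nth (carlitz_exp - carlitz_exp_partial m :: 'a poly fract fps) n =
      (\<Sum>i<M. fps_nth (carlitz_exp_term i :: 'a poly fract fps) n) -
      (\<Sum>i<m. fps_nth (carlitz_exp_term i :: 'a poly fract fps) n)"
    by (simp add: carlitz_exp_partial_def fps_sum_nth flip: M(3))
  also have "\<dots> = (\<Sum>i\<in>{..<M} - {..<m}. fps_nth (carlitz_exp_term i :: 'a poly fract fps) n)"
    using M(2) by (subst sum_diff) auto
  also have "\<dots> = (\<Sum>i | m \<le> i \<and> n = CARD('a) ^ i. 1 / carlitz_D i)"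
    using M(1) by (intro sum.mono_neutral_cong_right)
      (auto simp: carlitz_exp_term_nth intro: less_trans[OF exp_gt])
  finally show ?thesis .
qed

lemma subdegree_carlitz_exp_diff:
  "subdegree (carlitz_exp - carlitz_exp_partial m :: 'a::{field,finite} poly fract fps) =
     CARD('a) ^ m"
proof (rule subdegreeI)
  have "{i. m \<le> i \<and> CARD('a) ^ m = CARD('a) ^ i} = {m}"
    using CARD_field_ge_2[where 'a='a] by auto
  thus "fps_nth (carlitz_exp - carlitz_exp_partial m :: 'a poly fract fps) (CARD('a) ^ m) \<noteq> 0"
    by (simp add: carlitz_exp_diff_nth carlitz_D_nonzero del: power_inject_exp fps_sub_nth)
next
  fix n assume "n < CARD('a) ^ m"
  hence "{i. m \<le> i \<and> n = CARD('a) ^ i} = {}"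
    using CARD_field_ge_2[where 'a='a] by auto
  thus "fps_nth (carlitz_exp - carlitz_exp_partial m :: 'a poly fract fps) n = 0"
    by (simp only: carlitz_exp_diff_nth sum.empty)
qed

lemma BC_generating_function:
  "(carlitz_exp - carlitz_exp_partial N) * Abs_fps (\<lambda>n. BC N n / carlitz_fact n) =
     (carlitz_exp_term N :: 'a::{field,finite} poly fract fps)"
proof -
  let ?G = "carlitz_exp - carlitz_exp_partial N :: 'a poly fract fps"
  have "Abs_fps (\<lambda>n. BC N n / carlitz_fact n) = carlitz_exp_term N / ?G"
    by (rule fps_ext) (simp add: BC_def carlitz_fact_nonzero)
  moreover have "?G dvd carlitz_exp_term N"
  proof -
    have sub: "subdegree (carlitz_exp_term N :: 'a poly fract fps) = CARD('a) ^ N"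
      by (rule subdegreeI) (simp_all add: carlitz_exp_term_nth carlitz_D_nonzero)
    have pos: "CARD('a) ^ N > 0" by simp
    have "?G \<noteq> 0" and "(carlitz_exp_term N :: 'a poly fract fps) \<noteq> 0"
      using sub pos subdegree_carlitz_exp_diff[of N, where 'a='a] by (metis subdegree_0 less_irrefl)+
    thus ?thesis
      by (simp add: fps_dvd_iff sub subdegree_carlitz_exp_diff)
  qed
  ultimately show ?thesis by simp
qed

lemma stirling_carlitz_generating_function:
  "fps_const (1 / carlitz_fact k) * (carlitz_exp - carlitz_exp_partial m) ^ k =
     Abs_fps (\<lambda>n. stirling_carlitz m n k / (carlitz_fact n :: 'a::{field,finite} poly fract))"
  by (rule fps_ext) (simp add: stirling_carlitz_def carlitz_fact_nonzero)

end

theory Submission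
  imports Defs
begin

text \<open>
  Dividing \<open>e\<^sub>C - \<E>\<^bsub>N-1\<^esub>\<close> by its leading term \<open>x ^ (r ^ N) / D\<^sub>N\<close> leaves a power
  series \<open>u\<close> with constant term 1, and \<open>BC\<^bsub>N,n\<^esub> / \<Pi>(n)\<close> is the n-th coefficient of \<open>1/u\<close>.
  The binomial theorem gives \<open>1/u - (\<Sum>k\<le>n. (n+1 choose k+1) (-1)^k u^k) = (1 - u)^(n+1) / u\<close>,
  and the right-hand side has no term of degree at most n. The coefficients of \<open>u^k\<close> are
  Stirling-Carlitz numbers up to normalisation.
\<close>

lemma fps_nth_inverse_binomial_sum:
  fixes u F :: "'a::comm_ring_1 fps"
  assumes u0: "fps_nth u 0 = 1" and uF: "u * F = 1"
  shows "fps_nth F n = (\<Sum>k\<le>n. of_nat (Suc n choose Suc k) * (-1) ^ k * fps_nth (u ^ k) n)"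
proof -
  define S where "S = (\<Sum>k\<le>n. of_nat (Suc n choose Suc k) * (-1) ^ k * u ^ k)"
  have "(1 - u) ^ Suc n = (\<Sum>k\<le>Suc n. of_nat (Suc n choose k) * (- u) ^ k)"
    using binomial_ring[of "- u" 1 "Suc n"] by simp
  \<comment> \<open>Every term except the one of index 0 is divisible by \<open>u\<close>; the shift
    needed to factor out \<open>u\<close> produces the coefficients
    \<open>Suc n choose Suc k\<close>.\<close>
  also have "\<dots> = 1 + (\<Sum>k\<le>n. of_nat (Suc n choose Suc k) * (- u) ^ Suc k)"
    by (subst sum.atMost_Suc_shift) simp
  also have "(\<Sum>k\<le>n. of_nat (Suc n choose Suc k) * (- u) ^ Suc k) = - (u * S)"
    unfolding S_def sum_distrib_left sum_negf[symmetric]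
    by (intro sum.cong refl) (simp add: power_minus[of u] algebra_simps del: binomial_Suc_Suc)
  finally have "(1 - u) ^ Suc n = 1 - u * S"
    by simp
  hence "F * (1 - u) ^ Suc n = F - u * F * S"
    by (simp only: right_diff_distrib mult_1_right mult_ac)
  hence "F - S = F * (1 - u) ^ Suc n"
    by (simp only: uF mult_1_left)
  \<comment> \<open>The convolution only meets coefficients of \<open>(1 - u) ^ Suc n\<close> up to
    index \<open>n\<close>, and these vanish since \<open>1 - u\<close> has constant term 0.\<close>
  moreover have "fps_nth (F * (1 - u) ^ Suc n) n = 0"
  proof -
    have "fps_nth ((1 - u) ^ Suc n) m = 0" if "m \<le> n" for m
      using startsby_zero_power_prefix[of "1 - u" "Suc n"] u0 that by auto
    thus ?thesis
      unfolding fps_mult_nth by (intro sum.neutral) simp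
  qed
  ultimately have "fps_nth F n = fps_nth S n"
    by (metis fps_sub_nth right_minus_eq)
  also have "fps_nth S n = (\<Sum>k\<le>n. of_nat (Suc n choose Suc k) * (-1) ^ k * fps_nth (u ^ k) n)"
  proof -
    have "of_nat c * (-1) ^ k * u ^ k = fps_const (of_nat c * (-1) ^ k) * u ^ k" for c k :: nat
      by (simp add: fps_of_nat flip: fps_const_mult fps_const_power fps_const_neg)
    thus ?thesis
      by (simp add: S_def fps_sum_nth del: binomial_Suc_Suc)
  qed
  finally show ?thesis .
qed

text \<open>The series \<open>u\<close> of the overview. Division by the monomial is a shift, which
  loses nothing because the difference has subdegree exactly \<open>CARD('a) ^ N\<close>.\<close>

definition carlitz_exp_unit :: "nat \<Rightarrow> 'a::{field,finite} poly fract fps" where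
  "carlitz_exp_unit N =
     fps_const (carlitz_D N) * fps_shift (CARD('a) ^ N) (carlitz_exp - carlitz_exp_partial N)"

lemma carlitz_exp_diff_eq_unit:
  "(carlitz_exp - carlitz_exp_partial N :: 'a::{field,finite} poly fract fps) =
     fps_const (1 / carlitz_D N) * carlitz_exp_unit N * fps_X ^ (CARD('a) ^ N)"
proof -
  have "(carlitz_exp - carlitz_exp_partial N :: 'a poly fract fps) =
      fps_shift (CARD('a) ^ N) (carlitz_exp - carlitz_exp_partial N) * fps_X ^ (CARD('a) ^ N)"
    using subdegree_decompose[of "carlitz_exp - carlitz_exp_partial N :: 'a poly fract fps"]
    unfolding subdegree_carlitz_exp_diff .
  also have "\<dots> = fps_const (1 / carlitz_D N) * carlitz_exp_unit N * fps_X ^ (CARD('a) ^ N)"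
    by (simp add: carlitz_exp_unit_def carlitz_D_nonzero flip: mult.assoc)
  finally show ?thesis .
qed

lemma carlitz_exp_unit_nth_0: "fps_nth (carlitz_exp_unit N :: 'a::{field,finite} poly fract fps) 0 = 1"
proof -
  have "{i. N \<le> i \<and> CARD('a) ^ N = CARD('a) ^ i} = {N}"
    using CARD_field_ge_2[where 'a='a] by auto
  hence "fps_nth (carlitz_exp - carlitz_exp_partial N :: 'a poly fract fps) (CARD('a) ^ N) =
      1 / carlitz_D N"
    by (simp only: carlitz_exp_diff_nth) simp
  thus ?thesis
    by (simp add: carlitz_exp_unit_def carlitz_D_nonzero del: fps_sub_nth)
qed

text \<open>Both sides of the generating function identity contain the nonzero leading term
  \<open>?Y\<close>, which cancels in an integral domain.\<close>

lemma carlitz_exp_unit_mult_BC: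
  "carlitz_exp_unit N * Abs_fps (\<lambda>n. BC N n / carlitz_fact n) =
     (1 :: 'a::{field,finite} poly fract fps)"
proof -
  let ?F = "Abs_fps (\<lambda>n. BC N n / carlitz_fact n) :: 'a poly fract fps"
  let ?Y = "fps_const (1 / carlitz_D N) * fps_X ^ (CARD('a) ^ N) :: 'a poly fract fps"
  have "?Y \<noteq> 0"
    by (simp add: carlitz_D_nonzero)
  moreover have "?Y * (carlitz_exp_unit N * ?F) = ?Y * 1"
    using BC_generating_function[of N, where 'a='a]
    unfolding carlitz_exp_diff_eq_unit carlitz_exp_term_def by (simp add: mult_ac)
  ultimately show ?thesis
    by (rule mult_left_cancel[THEN iffD1])
qed

text \<open>The k-th power of the difference is \<open>u ^ k\<close> times the k-th power of the
  leading term, so degree \<open>n\<close> moves to \<open>n + k * CARD('a) ^ N\<close>, where the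
  Stirling-Carlitz number is read off.\<close>

lemma fps_nth_carlitz_exp_unit_power:
  "fps_nth (carlitz_exp_unit N ^ k) n =
     carlitz_D N ^ k * carlitz_fact k / carlitz_fact (n + k * CARD('a) ^ N) *
     (stirling_carlitz N (n + k * CARD('a) ^ N) k :: 'a::{field,finite} poly fract)"
proof -
  let ?M = "CARD('a) ^ N"
  have "(carlitz_exp - carlitz_exp_partial N :: 'a poly fract fps) ^ k =
      fps_const ((1 / carlitz_D N) ^ k) * (carlitz_exp_unit N ^ k * fps_X ^ (k * ?M))"
    unfolding carlitz_exp_diff_eq_unit
    by (simp add: power_mult_distrib mult.assoc mult.commute[of k] power_mult)
  hence "fps_nth ((carlitz_exp - carlitz_exp_partial N :: 'a poly fract fps) ^ k) (n + k * ?M) =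
      (1 / carlitz_D N) ^ k * fps_nth (carlitz_exp_unit N ^ k) n"
    by (simp add: fps_X_power_mult_right_nth)
  thus ?thesis
    by (simp add: stirling_carlitz_def carlitz_fact_nonzero carlitz_D_nonzero power_divide)
qed

theorem theorem3:
  fixes N n :: nat
  assumes "N \<ge> 1" and "n \<ge> 1"
  shows "(BC N n :: 'a::{field,finite} poly fract) =
    carlitz_fact n * (\<Sum>k=1..n. of_nat ((n + 1) choose (k + 1)) *
      ((- carlitz_D N) ^ k * carlitz_fact k / carlitz_fact (n + k * CARD('a) ^ N)) *
      stirling_carlitz N (n + k * CARD('a) ^ N) k)"
proof -
  let ?u = "carlitz_exp_unit N :: 'a poly fract fps"
  have "(BC N n / carlitz_fact n :: 'a poly fract) =
      (\<Sum>k\<le>n. of_nat (Suc n choose Suc k) * (-1) ^ k * fps_nth (?u ^ k) n)"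
    using fps_nth_inverse_binomial_sum[OF carlitz_exp_unit_nth_0 carlitz_exp_unit_mult_BC, of N n]
    by (simp del: binomial_Suc_Suc)
  also have "\<dots> = (\<Sum>k=1..n. of_nat (Suc n choose Suc k) * (-1) ^ k * fps_nth (?u ^ k) n)"
  proof (intro sum.mono_neutral_right ballI)
    fix k assume "k \<in> {..n} - {1..n}"
    hence "k = 0" by auto
    \<comment> \<open>Here \<open>?u ^ 0 = 1\<close>, whose n-th coefficient is 0 because n \<ge>
      1.\<close>
    thus "of_nat (Suc n choose Suc k) * (-1) ^ k * fps_nth (?u ^ k) n = 0"
      using assms(2) by simp
  qed auto
  \<comment> \<open>The sign \<open>(-1) ^ k\<close> merges with the normalising factor
    \<open>carlitz_D N ^ k\<close>.\<close>
  also have "\<dots> = (\<Sum>k=1..n. of_nat ((n + 1) choose (k + 1)) *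
      ((- carlitz_D N) ^ k * carlitz_fact k / carlitz_fact (n + k * CARD('a) ^ N)) *
      stirling_carlitz N (n + k * CARD('a) ^ N) k)"
    by (intro sum.cong refl)
      (simp add: fps_nth_carlitz_exp_unit_power power_minus[of "carlitz_D N"] mult.assoc
        del: binomial_Suc_Suc)
  finally show ?thesis
    by (simp add: carlitz_fact_nonzero divide_eq_eq mult.commute)
qed

end
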